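(* Let $n,p\ge1$. If $\mathcal{S}\in\mathbb{C}^{2n\times2n\times p}$ is T-symplectic, then it is invertible (with respect to the T-product), and its inverse is given by $$\mathcal{S}^{-1}=-\mathcal{J}*\mathcal{S}^H*\mathcal{J}.$$
   Context: A tensor $\mathcal{A}\in\mathbb{C}^{m\times n\times p}$ has frontal slices $\boldsymbol{A}^{(1)},\dots,\boldsymbol{A}^{(p)}\in\mathbb{C}^{m\times n}$. With $\omega=e^{2\pi\sqrt{-1}/p}$, its Fourier-domain slices are $\widehat{\boldsymbol{A}}^{(i)}=\sum_{j=1}^{p}\omega^{(i-1)(j-1)}\boldsymbol{A}^{(j)}$, $i=1,\dots,p$. Let $\operatorname{bcirc}(\mathcal{A})\in\mathbb{C}^{mp\times np}$ be the block circulant matrix whose $(r,s)$ block is $\boldsymbol{A}^{(((r-s)\bmod p)+1)}$. The T-product $\mathcal{A}*\mathcal{B}$ is the tensor with $\operatorname{bcirc}(\mathcal{A}*\mathcal{B})=\operatorname{bcirc}(\mathcal{A})\operatorname{bcirc}(\mathcal{B})$; equivalently, if $\mathcal{C}=\mathcal{A}*\mathcal{B}$ then $\widehat{\boldsymbol{C}}^{(i)}=\widehat{\boldsymbol{A}}^{(i)}\widehat{\boldsymbol{B}}^{(i)}$ for all $i$. The T-conjugate transpose $\mathcal{A}^H$ has frontal slices $(\boldsymbol{A}^{(1)})^H$ for $k=1$ and $(\boldsymbol{A}^{(p-k+2)})^H$ for $k\ge2$ (so that $\operatorname{bcirc}(\mathcal{A}^H)=\operatorname{bcirc}(\mathcal{A})^H$).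 The identity tensor $\mathcal{I}_{m,p}\in\mathbb{R}^{m\times m\times p}$ has first frontal slice $\boldsymbol{I}_m$ and all other frontal slices zero; $\mathcal{S}\in\mathbb{C}^{m\times m\times p}$ is invertible with inverse $\mathcal{R}=\mathcal{S}^{-1}$ if $\mathcal{S}*\mathcal{R}=\mathcal{R}*\mathcal{S}=\mathcal{I}_{m,p}$. Let $\boldsymbol{J}=\begin{bmatrix}\boldsymbol{0}&\boldsymbol{I}_n\\-\boldsymbol{I}_n&\boldsymbol{0}\end{bmatrix}$. The T-symplectic unit tensor $\mathcal{J}\in\mathbb{R}^{2n\times2n\times p}$ is the tensor all of whose Fourier-domain slices equal $\boldsymbol{J}$. A tensor $\mathcal{S}\in\mathbb{C}^{2n\times2n\times p}$ is T-symplectic if $\mathcal{S}^H*\mathcal{J}*\mathcal{S}=\mathcal{J}$. *)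

theory Defs
  imports "Jordan_Normal_Form.Schur_Decomposition"
begin

text \<open>A third-order tensor is the list of its frontal slices. The slice that is usually numbered
  \<open>k\<close> with \<open>1 \<le> k \<le> p\<close> is \<open>A ! (k - 1)\<close>, so all slice and block indices below are shifted by one.\<close>

type_synonym tensor = "complex mat list"

definition tensors :: "nat \<Rightarrow> nat \<Rightarrow> nat \<Rightarrow> tensor set" where
  "tensors m n p = {A. length A = p \<and> set A \<subseteq> carrier_mat m n}"

text \<open>The row and column numbers are read off the first slice, so they are meaningful
  for \<open>p \<ge> 1\<close> only.\<close>

definition trows :: "tensor \<Rightarrow> nat" where
  "trows A = dim_row (A ! 0)"

definition tcols :: "tensor \<Rightarrow> nat" where
  "tcols A = dim_col (A ! 0)"

definition fourier_slice :: "tensor \<Rightarrow> nat \<Rightarrow> complex mat" where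
  "fourier_slice A i =
     (let p = length A; w = exp (2 * of_real pi * \<i> / of_nat p)
      in mat (trows A) (tcols A) (\<lambda>(a, b). \<Sum>j<p. w ^ (i * j) * (A ! j) $$ (a, b)))"

definition bcirc :: "tensor \<Rightarrow> complex mat" where
  "bcirc A =
     (let p = length A; m = trows A; n = tcols A
      in mat (m * p) (n * p) (\<lambda>(a, b).
           (A ! nat ((int (a div m) - int (b div n)) mod int p)) $$ (a mod m, b mod n)))"

text \<open>Existence and uniqueness of the tensor described here is \<open>tprod_unique\<close> below.\<close>

definition tprod :: "tensor \<Rightarrow> tensor \<Rightarrow> tensor"  (infixl \<open>*\<^sub>T\<close> 70) where
  "A *\<^sub>T B = (THE C. C \<in> tensors (trows A) (tcols B) (length A) \<and> bcirc C = bcirc A * bcirc B)"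

definition tadjoint :: "tensor \<Rightarrow> tensor" where
  "tadjoint A = map (\<lambda>k. mat_adjoint (A ! (if k = 0 then 0 else length A - k))) [0..<length A]"

definition tuminus :: "tensor \<Rightarrow> tensor" where
  "tuminus A = map uminus A"

definition tidentity :: "nat \<Rightarrow> nat \<Rightarrow> tensor" where
  "tidentity m p = 1\<^sub>m m # replicate (p - 1) (0\<^sub>m m m)"

definition is_tinverse :: "tensor \<Rightarrow> tensor \<Rightarrow> bool" where
  "is_tinverse S R \<longleftrightarrow>
     (let m = trows S; p = length S
      in S \<in> tensors m m p \<and> R \<in> tensors m m p \<and>
         S *\<^sub>T R = tidentity m p \<and> R *\<^sub>T S = tidentity m p)"

definition tinvertible :: "tensor \<Rightarrow> bool" where
  "tinvertible S \<longleftrightarrow> (\<exists>R. is_tinverse S R)"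

text \<open>Meaningful for invertible \<open>S\<close>; see \<open>is_tinverse_unique\<close> below.\<close>

definition tinverse :: "tensor \<Rightarrow> tensor" where
  "tinverse S = (THE R. is_tinverse S R)"

definition Jmat :: "nat \<Rightarrow> complex mat" where
  "Jmat n = four_block_mat (0\<^sub>m n n) (1\<^sub>m n) (- 1\<^sub>m n) (0\<^sub>m n n)"

text \<open>Existence and uniqueness, together with an explicit (real) form, is \<open>Jtensor_unique\<close>
  and \<open>Jtensor_eq\<close> below.\<close>

definition Jtensor :: "nat \<Rightarrow> nat \<Rightarrow> tensor" where
  "Jtensor n p = (THE T. T \<in> tensors (2 * n) (2 * n) p \<and> (\<forall>i<p. fourier_slice T i = Jmat n))"

definition tsymplectic :: "nat \<Rightarrow> nat \<Rightarrow> tensor \<Rightarrow> bool" where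
  "tsymplectic n p S \<longleftrightarrow>
     S \<in> tensors (2 * n) (2 * n) p \<and> tadjoint S *\<^sub>T Jtensor n p *\<^sub>T S = Jtensor n p"


section \<open>Well-definedness\<close>

lemma tensors_nth: "A \<in> tensors m n p \<Longrightarrow> k < p \<Longrightarrow> A ! k \<in> carrier_mat m n"
  by (auto simp: tensors_def)

lemma tensors_dims:
  assumes "A \<in> tensors m n p" "p \<ge> 1"
  shows "length A = p" "trows A = m" "tcols A = n"
  using assms tensors_nth[OF assms(1), of 0] by (auto simp: tensors_def trows_def tcols_def)

lemma block_less:
  fixes r i m p :: nat
  assumes "r < p" "i < m" shows "r * m + i < m * p"
proof -
  have "r * m + i < (r + 1) * m" using assms by simp
  also have "\<dots> \<le> p * m" using assms by (intro mult_right_mono) auto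
  finally show ?thesis by (simp add: mult.commute)
qed

lemma bcirc_carrier:
  assumes "A \<in> tensors m n p" "p \<ge> 1"
  shows "bcirc A \<in> carrier_mat (m * p) (n * p)"
  using tensors_dims[OF assms] by (simp add: bcirc_def Let_def)

lemma bcirc_nth:
  assumes "A \<in> tensors m n p" "r < p" "s < p" "i < m" "j < n"
  shows "bcirc A $$ (r * m + i, s * n + j) = (A ! nat ((int r - int s) mod int p)) $$ (i, j)"
proof -
  have "p \<ge> 1" using assms by auto
  note d = tensors_dims[OF assms(1) this]
  show ?thesis using assms block_less[of r p i m] block_less[of s p j n]
    by (simp add: bcirc_def Let_def d)
qed

lemma bcirc_inj:
  assumes A: "A \<in> tensors m n p" and B: "B \<in> tensors m n p" and eq: "bcirc A = bcirc B"
  shows "A = B"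
proof (rule nth_equalityI)
  show "length A = length B" using A B by (auto simp: tensors_def)
  fix k assume "k < length A"
  then have k: "k < p" using A by (auto simp: tensors_def)
  have c: "A ! k \<in> carrier_mat m n" "B ! k \<in> carrier_mat m n"
    using A B k tensors_nth by auto
  show "A ! k = B ! k"
  proof (rule eq_matI)
    fix i j assume "i < dim_row (B ! k)" "j < dim_col (B ! k)"
    then have ij: "i < m" "j < n" using c by auto
    have "0 < p" using k by auto
    then show "(A ! k) $$ (i, j) = (B ! k) $$ (i, j)"
      using bcirc_nth[OF A k _ ij, of 0] bcirc_nth[OF B k _ ij, of 0] eq k
      by simp
  qed (use c in auto)
qed

definition tconv :: "nat \<Rightarrow> nat \<Rightarrow> nat \<Rightarrow> nat \<Rightarrow> tensor \<Rightarrow> tensor \<Rightarrow> tensor" where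
  "tconv m n l p A B = map (\<lambda>k. mat m l (\<lambda>(i, j). \<Sum>s<p. \<Sum>t<n.
     (A ! nat ((int k - int s) mod int p)) $$ (i, t) * (B ! s) $$ (t, j))) [0..<p]"

lemma tconv_tensors: "tconv m n l p A B \<in> tensors m l p"
  by (auto simp: tensors_def tconv_def)

lemma mat_eq_blockI:
  fixes M N :: "complex mat"
  assumes "M \<in> carrier_mat (m * p) (l * p)" "N \<in> carrier_mat (m * p) (l * p)"
    and eq: "\<And>r s i j. r < p \<Longrightarrow> s < p \<Longrightarrow> i < m \<Longrightarrow> j < l \<Longrightarrow>
           M $$ (r * m + i, s * l + j) = N $$ (r * m + i, s * l + j)"
  shows "M = N"
proof (rule eq_matI)
  fix a b assume "a < dim_row N" "b < dim_col N"
  then have ab: "a < m * p" "b < l * p" using assms by auto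
  then have "m > 0" "l > 0" by (auto intro: gr0I)
  then have "a div m < p" "b div l < p" "a mod m < m" "b mod l < l"
    using ab by (auto simp: less_mult_imp_div_less mult.commute)
  from eq[OF this] show "M $$ (a, b) = N $$ (a, b)" by simp
qed (use assms in auto)

lemma sum_blocks: "(\<Sum>k<n * p. f k) = (\<Sum>s<p. \<Sum>t<n. f (s * n + t))"
  for f :: "nat \<Rightarrow> complex"
proof -
  have "(\<Sum>k<n * p. f k) = (\<Sum>s<p. sum f {s * n..<s * n + n})"
    using sum.nat_group[of f n p] by (simp add: mult.commute)
  also have "\<dots> = (\<Sum>s<p. \<Sum>t<n. f (s * n + t))"
  proof (rule sum.cong[OF refl])
    fix s
    show "sum f {s * n..<s * n + n} = (\<Sum>t<n. f (s * n + t))"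
      by (rule sum.reindex_bij_witness[of _ "\<lambda>t. s * n + t" "\<lambda>t. t - s * n"]) auto
  qed
  finally show ?thesis .
qed

lemma bij_shift:
  assumes "s < (p::nat)"
  shows "bij_betw (\<lambda>v. nat ((int v - int s) mod int p)) {..<p} {..<p}"
proof (rule bij_betw_byWitness[where f' = "\<lambda>u. (u + s) mod p"])
  have p: "p > 0" using assms by simp
  have *: "nat ((int v - int s) mod int p) < p" for v
    using p by (simp add: nat_less_iff)
  show "(\<lambda>v. nat ((int v - int s) mod int p)) ` {..<p} \<subseteq> {..<p}" using * by auto
  show "(\<lambda>u. (u + s) mod p) ` {..<p} \<subseteq> {..<p}" using p by auto
  show "\<forall>v\<in>{..<p}. (nat ((int v - int s) mod int p) + s) mod p = v"
  proof
    fix v assume "v \<in> {..<p}"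
    have "int ((nat ((int v - int s) mod int p) + s) mod p) = int v"
      using p \<open>v \<in> _\<close> by (simp add: zmod_int mod_add_left_eq)
    then show "(nat ((int v - int s) mod int p) + s) mod p = v" by linarith
  qed
  show "\<forall>u\<in>{..<p}. nat ((int ((u + s) mod p) - int s) mod int p) = u"
    using p by (auto simp: zmod_int mod_diff_left_eq)
qed

lemma bcirc_tconv:
  assumes A: "A \<in> tensors m n p" and B: "B \<in> tensors n l p" and p: "p \<ge> 1"
  shows "bcirc (tconv m n l p A B) = bcirc A * bcirc B"
proof (rule mat_eq_blockI)
  note cA = bcirc_carrier[OF A p] and cB = bcirc_carrier[OF B p]
  show "bcirc (tconv m n l p A B) \<in> carrier_mat (m * p) (l * p)"
    using bcirc_carrier[OF tconv_tensors p] .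
  show "bcirc A * bcirc B \<in> carrier_mat (m * p) (l * p)" using cA cB by auto
  fix r s i j assume h: "r < p" "s < p" "i < m" "j < l"
  let ?d = "\<lambda>a b. nat ((int a - int b) mod int p)"
  have d: "?d a b < p" for a b using p by (simp add: nat_less_iff)
  have di: "int (?d a b) = (int a - int b) mod int p" for a b using p by simp
  have "bcirc (tconv m n l p A B) $$ (r * m + i, s * l + j) = (tconv m n l p A B ! ?d r s) $$ (i, j)"
    by (rule bcirc_nth[OF tconv_tensors h])
  also have "\<dots> = (\<Sum>u<p. \<Sum>t<n. (A ! ?d (?d r s) u) $$ (i, t) * (B ! u) $$ (t, j))"
    using d[of r s] h by (simp add: tconv_def)
  also have "\<dots> = (\<Sum>v<p. \<Sum>t<n. (A ! ?d (?d r s) (?d v s)) $$ (i, t) * (B ! ?d v s) $$ (t, j))"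
    by (rule sum.reindex_bij_betw[OF bij_shift[OF h(2)], symmetric])
  also have "\<dots> = (\<Sum>v<p. \<Sum>t<n. bcirc A $$ (r * m + i, v * n + t) * bcirc B $$ (v * n + t, s * l + j))"
  proof (intro sum.cong refl)
    fix v t assume vt: "v \<in> {..<p}" "t \<in> {..<n}"
    have "?d (?d r s) (?d v s) = ?d r v"
      by (simp only: di mod_diff_eq) simp
    then show "(A ! ?d (?d r s) (?d v s)) $$ (i, t) * (B ! ?d v s) $$ (t, j) =
       bcirc A $$ (r * m + i, v * n + t) * bcirc B $$ (v * n + t, s * l + j)"
      using vt h by (simp add: bcirc_nth[OF A] bcirc_nth[OF B])
  qed
  also have "\<dots> = (\<Sum>k<n * p. bcirc A $$ (r * m + i, k) * bcirc B $$ (k, s * l + j))"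
    by (rule sum_blocks[symmetric])
  also have "\<dots> = (bcirc A * bcirc B) $$ (r * m + i, s * l + j)"
    using cA cB block_less[OF h(1,3)] block_less[OF h(2,4)]
    by (auto simp: scalar_prod_def lessThan_atLeast0 intro!: sum.cong)
  finally show "bcirc (tconv m n l p A B) $$ (r * m + i, s * l + j) =
      (bcirc A * bcirc B) $$ (r * m + i, s * l + j)" .
qed

lemma tprod_unique:
  assumes "A \<in> tensors m n p" "B \<in> tensors n l p" "p \<ge> 1"
  shows "\<exists>!C. C \<in> tensors (trows A) (tcols B) (length A) \<and> bcirc C = bcirc A * bcirc B"
  unfolding tensors_dims[OF assms(1,3)] tensors_dims[OF assms(2,3)]
proof (rule ex1I[of _ "tconv m n l p A B"])
  fix C assume "C \<in> tensors m l p \<and> bcirc C = bcirc A * bcirc B"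
  then show "C = tconv m n l p A B"
    using bcirc_inj[of C m l p] bcirc_tconv[OF assms] tconv_tensors by simp
qed (simp add: bcirc_tconv[OF assms] tconv_tensors)

lemma
  assumes "A \<in> tensors m n p" "B \<in> tensors n l p" "p \<ge> 1"
  shows tprod_tensors: "A *\<^sub>T B \<in> tensors m l p"
    and bcirc_tprod: "bcirc (A *\<^sub>T B) = bcirc A * bcirc B"
  using theI'[OF tprod_unique[OF assms]] tensors_dims[OF assms(1,3)] tensors_dims[OF assms(2,3)]
  by (auto simp: tprod_def)

lemma tprod_assoc:
  assumes A: "A \<in> tensors m n p" and B: "B \<in> tensors n l p" and C: "C \<in> tensors l q p"
    and p: "p \<ge> 1"
  shows "A *\<^sub>T B *\<^sub>T C = A *\<^sub>T (B *\<^sub>T C)"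
proof (rule bcirc_inj)
  note AB = tprod_tensors[OF A B p] and BC = tprod_tensors[OF B C p]
  show "A *\<^sub>T B *\<^sub>T C \<in> tensors m q p" "A *\<^sub>T (B *\<^sub>T C) \<in> tensors m q p"
    using tprod_tensors[OF AB C p] tprod_tensors[OF A BC p] .
  show "bcirc (A *\<^sub>T B *\<^sub>T C) = bcirc (A *\<^sub>T (B *\<^sub>T C))"
    using bcirc_carrier[OF A p] bcirc_carrier[OF B p] bcirc_carrier[OF C p]
    by (simp add: bcirc_tprod[OF AB C p] bcirc_tprod[OF A BC p] bcirc_tprod[OF A B p]
        bcirc_tprod[OF B C p] assoc_mult_mat)
qed

lemma tidentity_tensors: "p \<ge> 1 \<Longrightarrow> tidentity m p \<in> tensors m m p"
  by (auto simp: tidentity_def tensors_def)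

lemma bcirc_tidentity:
  assumes p: "p \<ge> 1"
  shows "bcirc (tidentity m p) = 1\<^sub>m (m * p)"
proof (rule mat_eq_blockI)
  show "bcirc (tidentity m p) \<in> carrier_mat (m * p) (m * p)"
    by (rule bcirc_carrier[OF tidentity_tensors[OF p] p])
  show "1\<^sub>m (m * p) \<in> carrier_mat (m * p) (m * p)" by simp
  fix r s i j assume h: "r < p" "s < p" "i < m" "j < m"
  let ?d = "nat ((int r - int s) mod int p)"
  have d: "?d < p" using p by (simp add: nat_less_iff)
  have d0: "?d = 0 \<longleftrightarrow> r = s"
  proof
    assume "?d = 0"
    then have "(int r - int s) mod int p = 0"
      using pos_mod_sign[of "int p" "int r - int s"] p by linarith
    then have "int r mod int p = int s mod int p" by (metis mod_eq_dvd_iff mod_0_imp_dvd)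
    then show "r = s" using h by simp
  qed simp
  have iff: "r * m + i = s * m + j \<longleftrightarrow> r = s \<and> i = j"
  proof
    assume e: "r * m + i = s * m + j"
    have "(r * m + i) div m = r" "(s * m + j) div m = s" using h by simp_all
    with e show "r = s \<and> i = j" by simp
  qed simp
  have "tidentity m p ! ?d = (if r = s then 1\<^sub>m m else 0\<^sub>m m m)"
  proof (cases "?d = 0")
    case True then show ?thesis using d0 by (simp add: tidentity_def)
  next
    case False then show ?thesis using d0 d by (simp add: tidentity_def nth_Cons')
  qed
  then show "bcirc (tidentity m p) $$ (r * m + i, s * m + j) = 1\<^sub>m (m * p) $$ (r * m + i, s * m + j)"
    using h iff block_less[OF h(1,3)] block_less[OF h(2,4)]
    by (simp add: bcirc_nth[OF tidentity_tensors[OF p] h])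
qed

lemma is_tinverse_unique:
  assumes p: "length S \<ge> 1" and R: "is_tinverse S R" and Q: "is_tinverse S Q"
  shows "R = Q"
proof (rule bcirc_inj)
  define m where "m = trows S"
  let ?p = "length S"
  have S: "S \<in> tensors m m ?p" and Rt: "R \<in> tensors m m ?p" and Qt: "Q \<in> tensors m m ?p"
    and 1: "R *\<^sub>T S = tidentity m ?p" and 2: "S *\<^sub>T Q = tidentity m ?p"
    using R Q by (auto simp: is_tinverse_def Let_def m_def)
  show "R \<in> tensors m m ?p" "Q \<in> tensors m m ?p" by fact+
  let ?N = "m * ?p"
  note c = bcirc_carrier[OF S p] bcirc_carrier[OF Rt p] bcirc_carrier[OF Qt p]
  have e1: "bcirc R * bcirc S = 1\<^sub>m ?N"
    using bcirc_tprod[OF Rt S p] 1 bcirc_tidentity[OF p] by simp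
  have e2: "bcirc S * bcirc Q = 1\<^sub>m ?N"
    using bcirc_tprod[OF S Qt p] 2 bcirc_tidentity[OF p] by simp
  have "bcirc R = bcirc R * (bcirc S * bcirc Q)" using e2 c by simp
  also have "\<dots> = bcirc R * bcirc S * bcirc Q" using c by (simp add: assoc_mult_mat)
  also have "\<dots> = bcirc Q" using e1 c by simp
  finally show "bcirc R = bcirc Q" .
qed

lemma tinverse_eqI: "length S \<ge> 1 \<Longrightarrow> is_tinverse S R \<Longrightarrow> tinverse S = R"
  unfolding tinverse_def using is_tinverse_unique by blast

lemma fourier_slice_carrier: "A \<in> tensors m n p \<Longrightarrow> p \<ge> 1 \<Longrightarrow> fourier_slice A i \<in> carrier_mat m n"
  using tensors_dims[of A m n p] by (simp add: fourier_slice_def Let_def)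

lemma fourier_orthogonality:
  fixes p :: nat
  assumes "j < p" "k < p"
  defines "w \<equiv> exp (2 * of_real pi * \<i> / of_nat p)"
  shows "(\<Sum>i<p. w ^ (i * j) / w ^ (i * k)) = (if j = k then of_nat p else 0)"
proof (cases "j = k")
  case True
  then show ?thesis by (simp add: w_def)
next
  case False
  have p: "p > 0" using assms by simp
  have wk: "w ^ k = cis (2 * pi * real k / real p)" for k
    by (simp add: w_def cis_conv_exp exp_of_nat_mult[symmetric] mult_ac)
  have w0: "w \<noteq> 0" by (simp add: w_def)
  have "inj_on (\<lambda>k. cis (2 * pi * real k / real p)) {..<p}"
    using bij_betw_roots_unity[OF p] by (simp add: bij_betw_def)
  with False assms(1,2) have "w ^ j \<noteq> w ^ k" unfolding wk inj_on_def by auto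
  then have z1: "w ^ j / w ^ k \<noteq> 1" using w0 by simp
  have wp: "w ^ p = 1" using wk[of p] p by (simp add: cis_2pi)
  have "(w ^ j / w ^ k) ^ p = (w ^ p) ^ j / (w ^ p) ^ k"
    by (simp add: power_divide power_mult[symmetric] mult.commute)
  then have zp: "(w ^ j / w ^ k) ^ p = 1" using wp by simp
  have "(\<Sum>i<p. w ^ (i * j) / w ^ (i * k)) = (\<Sum>i<p. (w ^ j / w ^ k) ^ i)"
    by (simp add: power_divide power_mult[symmetric] mult.commute)
  also have "\<dots> = 0" using geometric_sum[OF z1, of p] zp by simp
  finally show ?thesis using False by simp
qed

lemma fourier_slice_inj:
  assumes A: "A \<in> tensors m n p" and B: "B \<in> tensors m n p"
    and eq: "\<And>i. i < p \<Longrightarrow> fourier_slice A i = fourier_slice B i"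
  shows "A = B"
proof (rule nth_equalityI)
  show "length A = length B" using A B by (auto simp: tensors_def)
  fix k assume "k < length A"
  then have k: "k < p" using A by (auto simp: tensors_def)
  then have p: "p \<ge> 1" by simp
  have c: "A ! k \<in> carrier_mat m n" "B ! k \<in> carrier_mat m n"
    using A B k tensors_nth by auto
  define w where "w = exp (2 * complex_of_real pi * \<i> / of_nat p)"
  have inv: "of_nat p * (C ! k) $$ (a, b) = (\<Sum>i<p. fourier_slice C i $$ (a, b) / w ^ (i * k))"
    if C: "C \<in> tensors m n p" and ab: "a < m" "b < n" for C a b
  proof -
    have "(\<Sum>i<p. fourier_slice C i $$ (a, b) / w ^ (i * k))
        = (\<Sum>i<p. \<Sum>j<p. (C ! j) $$ (a, b) * (w ^ (i * j) / w ^ (i * k)))"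
      using ab unfolding fourier_slice_def Let_def tensors_dims[OF C p] w_def[symmetric]
      by (simp add: sum_divide_distrib mult_ac)
    also have "\<dots> = (\<Sum>j<p. (C ! j) $$ (a, b) * (\<Sum>i<p. w ^ (i * j) / w ^ (i * k)))"
      by (subst sum.swap) (simp add: sum_distrib_left)
    also have "\<dots> = (\<Sum>j<p. (C ! j) $$ (a, b) * (if j = k then of_nat p else 0))"
      using k by (intro sum.cong refl) (simp add: fourier_orthogonality w_def)
    also have "\<dots> = (\<Sum>j<p. if j = k then (C ! j) $$ (a, b) * of_nat p else 0)"
      by (intro sum.cong) auto
    also have "\<dots> = of_nat p * (C ! k) $$ (a, b)"
      using k by simp
    finally show ?thesis by simp
  qed
  show "A ! k = B ! k"
  proof (rule eq_matI)
    fix a b assume "a < dim_row (B ! k)" "b < dim_col (B ! k)"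
    then have ab: "a < m" "b < n" using c by auto
    have "of_nat p * (A ! k) $$ (a, b) = of_nat p * (B ! k) $$ (a, b)"
      unfolding inv[OF A ab] inv[OF B ab] using eq by simp
    then show "(A ! k) $$ (a, b) = (B ! k) $$ (a, b)" using p by simp
  qed (use c in auto)
qed

lemma Jmat_carrier: "Jmat n \<in> carrier_mat (2 * n) (2 * n)"
  by (simp add: Jmat_def mult_2)

lemma Jtensor_explicit:
  fixes n p :: nat
  assumes p: "p \<ge> 1"
  defines "T \<equiv> Jmat n # replicate (p - 1) (0\<^sub>m (2 * n) (2 * n))"
  shows "T \<in> tensors (2 * n) (2 * n) p \<and> (\<forall>i<p. fourier_slice T i = Jmat n)"
proof -
  have T: "T \<in> tensors (2 * n) (2 * n) p"
    using p Jmat_carrier by (auto simp: T_def tensors_def)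
  have "fourier_slice T i = Jmat n" for i
  proof (rule eq_matI)
    fix a b assume "a < dim_row (Jmat n)" "b < dim_col (Jmat n)"
    then have ab: "a < 2 * n" "b < 2 * n" using Jmat_carrier[of n] by auto
    have nz: "(T ! j) $$ (a, b) = (if j = 0 then Jmat n $$ (a, b) else 0)" if "j < p" for j
      using that ab by (cases j) (auto simp: T_def)
    show "fourier_slice T i $$ (a, b) = Jmat n $$ (a, b)"
      using ab p by (simp add: fourier_slice_def Let_def tensors_dims[OF T p] nz if_distrib
          cong: if_cong)
  qed (use fourier_slice_carrier[OF T p, of i] Jmat_carrier[of n] in auto)
  with T show ?thesis by blast
qed

lemma Jtensor_unique:
  assumes "p \<ge> 1"
  shows "\<exists>!T. T \<in> tensors (2 * n) (2 * n) p \<and> (\<forall>i<p. fourier_slice T i = Jmat n)"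
proof (rule ex1I[of _ "Jmat n # replicate (p - 1) (0\<^sub>m (2 * n) (2 * n))"],
    rule Jtensor_explicit[OF assms])
  fix T assume "T \<in> tensors (2 * n) (2 * n) p \<and> (\<forall>i<p. fourier_slice T i = Jmat n)"
  then show "T = Jmat n # replicate (p - 1) (0\<^sub>m (2 * n) (2 * n))"
    using Jtensor_explicit[OF assms, of n] by (intro fourier_slice_inj[of T]) auto
qed

lemma Jtensor_eq:
  assumes "p \<ge> 1"
  shows "Jtensor n p = Jmat n # replicate (p - 1) (0\<^sub>m (2 * n) (2 * n))"
  unfolding Jtensor_def
  by (rule the1_equality[OF Jtensor_unique[OF assms] Jtensor_explicit[OF assms]])

end

theory Submission
  imports Defs
begin

text \<open>Since \<open>\<J> * \<J> = - \<I>\<close>, multiplying \<open>\<S>\<^sup>H * \<J> * \<S> = \<J>\<close> by \<open>- \<J>\<close> on the left shows that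
  \<open>- \<J> * \<S>\<^sup>H * \<J>\<close> is a left inverse of \<open>\<S>\<close>. Passing to the square matrices \<open>bcirc\<close>, a left inverse
  is also a right inverse.\<close>

text \<open>The block circulant matrix of such a tensor is block diagonal with \<open>p\<close>
  copies of \<open>M\<close>, so these tensors multiply like matrices. The identity tensor,
  \<open>Jtensor\<close> and its negative all have this form, which reduces identities among them to
  matrix identities.\<close>

definition slice_tensor :: "nat \<Rightarrow> complex mat \<Rightarrow> tensor" where
  "slice_tensor p M = M # replicate (p - 1) (0\<^sub>m (dim_row M) (dim_col M))"

lemma slice_tensor_tensors:
  "M \<in> carrier_mat m n \<Longrightarrow> p \<ge> 1 \<Longrightarrow> slice_tensor p M \<in> tensors m n p"
  by (auto simp: slice_tensor_def tensors_def)

lemma slice_tensor_nth: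
  assumes "M \<in> carrier_mat m n" "k < p"
  shows "slice_tensor p M ! k = (if k = 0 then M else 0\<^sub>m m n)"
  using assms by (auto simp: slice_tensor_def nth_Cons')

text \<open>Replaces the definite description behind the T-product by an explicit circular
  convolution, so that single slices can be computed.\<close>

lemma tprod_eq_tconv:
  assumes "A \<in> tensors m n p" "B \<in> tensors n l p" "p \<ge> 1"
  shows "A *\<^sub>T B = tconv m n l p A B"
  using bcirc_inj[OF tprod_tensors[OF assms] tconv_tensors]
  by (simp add: bcirc_tprod[OF assms] bcirc_tconv[OF assms])

text \<open>In the circular convolution every term with a nonzero slice index of the second factor
  vanishes. Slice \<open>k\<close> of the product is therefore slice \<open>k\<close> of the first
  factor times \<open>N\<close>.\<close>

lemma slice_tensor_tprod:
  assumes M: "M \<in> carrier_mat m n" and N: "N \<in> carrier_mat n l" and p: "p \<ge> 1"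
  shows "slice_tensor p M *\<^sub>T slice_tensor p N = slice_tensor p (M * N)"
proof (rule nth_equalityI)
  note MN = mult_carrier_mat[OF M N]
  note eq = tprod_eq_tconv[OF slice_tensor_tensors[OF M p] slice_tensor_tensors[OF N p] p]
  show "length (slice_tensor p M *\<^sub>T slice_tensor p N) = length (slice_tensor p (M * N))"
    unfolding eq using p by (simp add: tconv_def slice_tensor_def)
  fix k assume "k < length (slice_tensor p M *\<^sub>T slice_tensor p N)"
  then have k: "k < p" by (simp add: eq tconv_def)
  show "(slice_tensor p M *\<^sub>T slice_tensor p N) ! k = slice_tensor p (M * N) ! k"
  proof (rule eq_matI)
    fix i j
    assume "i < dim_row (slice_tensor p (M * N) ! k)" "j < dim_col (slice_tensor p (M * N) ! k)"
    then have ij: "i < m" "j < l"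
      using slice_tensor_nth[OF MN k] M N by (auto split: if_splits)
    have "(slice_tensor p M *\<^sub>T slice_tensor p N) ! k $$ (i, j) =
      (\<Sum>s<p. \<Sum>t<n. (slice_tensor p M ! nat ((int k - int s) mod int p)) $$ (i, t) *
        (slice_tensor p N ! s) $$ (t, j))"
      using k ij by (simp add: eq tconv_def)
    \<comment> \<open>At \<open>s = 0\<close> the cyclic index \<open>(k - s) mod p\<close> is
      \<open>k\<close> itself, because \<open>k < p\<close>.\<close>
    also have "\<dots> = (\<Sum>s<p. if s = 0 then
        \<Sum>t<n. (slice_tensor p M ! k) $$ (i, t) * N $$ (t, j) else 0)"
      using ij k by (intro sum.cong) (auto simp: slice_tensor_nth[OF N])
    also have "\<dots> = (\<Sum>t<n. (slice_tensor p M ! k) $$ (i, t) * N $$ (t, j))"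
      using p by simp
    also have "\<dots> = (slice_tensor p (M * N) ! k) $$ (i, j)"
      using M N ij by (simp add: slice_tensor_nth[OF M k] slice_tensor_nth[OF MN k]
          scalar_prod_def lessThan_atLeast0)
    finally show "(slice_tensor p M *\<^sub>T slice_tensor p N) ! k $$ (i, j) =
      (slice_tensor p (M * N) ! k) $$ (i, j)" .
  qed (use k M N in \<open>auto simp: slice_tensor_nth[OF MN k] eq tconv_def\<close>)
qed

lemma tuminus_slice_tensor: "tuminus (slice_tensor p M) = slice_tensor p (- M)"
  by (auto simp: tuminus_def slice_tensor_def intro!: eq_matI)

lemma tidentity_eq_slice_tensor: "tidentity m p = slice_tensor p (1\<^sub>m m)"
  by (simp add: tidentity_def slice_tensor_def)

lemma Jtensor_eq_slice_tensor: "p \<ge> 1 \<Longrightarrow> Jtensor n p = slice_tensor p (Jmat n)"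
  using Jmat_carrier[of n] by (simp add: Jtensor_eq slice_tensor_def)

lemma Jmat_square: "Jmat n * Jmat n = - 1\<^sub>m (2 * n)"
proof -
  have "Jmat n * Jmat n = four_block_mat (- 1\<^sub>m n) (0\<^sub>m n n) (0\<^sub>m n n) (- 1\<^sub>m n)"
    unfolding Jmat_def by (subst mult_four_block_mat) auto
  also have "\<dots> = - 1\<^sub>m (2 * n)"
    by (rule eq_matI) (auto simp: mult_2)
  finally show ?thesis .
qed

text \<open>Follows from the square of \<open>Jmat n\<close> being minus the identity. It makes the
  leading factor of the claimed inverse cancel the \<open>Jtensor\<close> that the symplectic
  condition produces.\<close>

lemma tuminus_Jtensor_tprod_Jtensor:
  assumes "p \<ge> 1"
  shows "tuminus (Jtensor n p) *\<^sub>T Jtensor n p = tidentity (2 * n) p"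
proof -
  have "- Jmat n * Jmat n = 1\<^sub>m (2 * n)"
    using Jmat_carrier[of n] by (simp add: Jmat_square)
  then show ?thesis
    using Jmat_carrier[of n] assms
    by (simp add: Jtensor_eq_slice_tensor tuminus_slice_tensor tidentity_eq_slice_tensor
        slice_tensor_tprod[of _ "2 * n" "2 * n" _ "2 * n"])
qed

lemma tadjoint_tensors:
  assumes "A \<in> tensors m n p"
  shows "tadjoint A \<in> tensors n m p"
proof -
  have len: "length A = p" using assms by (simp add: tensors_def)
  have "mat_adjoint M \<in> carrier_mat n m" if "M \<in> carrier_mat m n" for M :: "complex mat"
    using that by (auto simp: mat_adjoint_def)
  then show ?thesis
    using tensors_nth[OF assms] by (auto simp: tensors_def tadjoint_def len)
qed

text \<open>One-sided inverses of square complex matrices are two-sided. Since \<open>bcirc\<close>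
  is multiplicative and injective, this carries back to tensors.\<close>

lemma is_tinverse_if_left_inverse:
  assumes S: "S \<in> tensors m m p" and R: "R \<in> tensors m m p" and p: "p \<ge> 1"
    and RS: "R *\<^sub>T S = tidentity m p"
  shows "is_tinverse S R"
proof -
  have "bcirc R * bcirc S = 1\<^sub>m (m * p)"
    using RS by (simp add: bcirc_tprod[OF R S p, symmetric] bcirc_tidentity[OF p])
  then have "bcirc S * bcirc R = 1\<^sub>m (m * p)"
    by (rule mat_mult_left_right_inverse[OF bcirc_carrier[OF R p] bcirc_carrier[OF S p]])
  then have "S *\<^sub>T R = tidentity m p"
    using bcirc_inj[OF tprod_tensors[OF S R p] tidentity_tensors[OF p]]
    by (simp add: bcirc_tprod[OF S R p] bcirc_tidentity[OF p])
  with S R RS show ?thesis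
    by (simp add: is_tinverse_def Let_def tensors_dims[OF S p])
qed

theorem proposition3p12:
  fixes n p :: nat and S :: tensor
  assumes "n \<ge> 1" and "p \<ge> 1"
    and "tsymplectic n p S"
  shows "tinvertible S \<and>
         tinverse S = tuminus (Jtensor n p) *\<^sub>T tadjoint S *\<^sub>T Jtensor n p"
proof -
  note p = \<open>p \<ge> 1\<close>
  let ?T = "tensors (2 * n) (2 * n) p"
  let ?J = "Jtensor n p" and ?SH = "tadjoint S"
  let ?R = "tuminus ?J *\<^sub>T ?SH *\<^sub>T ?J"
  have S: "S \<in> ?T" and symp: "?SH *\<^sub>T ?J *\<^sub>T S = ?J"
    using assms(3) by (auto simp: tsymplectic_def)
  have SH: "?SH \<in> ?T" by (rule tadjoint_tensors[OF S])
  have J: "?J \<in> ?T" and mJ: "tuminus ?J \<in> ?T"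
    using p Jmat_carrier[of n]
    by (simp_all add: Jtensor_eq_slice_tensor tuminus_slice_tensor slice_tensor_tensors)
  note SHJ = tprod_tensors[OF SH J p]
  have R: "?R \<in> ?T" by (rule tprod_tensors[OF tprod_tensors[OF mJ SH p] J p])
  \<comment> \<open>Two reassociations isolate the left-hand side of the symplectic condition, which
    is bracketed to the left, as the right factor.\<close>
  have "?R *\<^sub>T S = tuminus ?J *\<^sub>T (?SH *\<^sub>T ?J *\<^sub>T S)"
    by (simp add: tprod_assoc[OF mJ SH J p] tprod_assoc[OF mJ SHJ S p])
  also have "\<dots> = tidentity (2 * n) p"
    by (simp add: symp tuminus_Jtensor_tprod_Jtensor[OF p])
  finally have inv: "is_tinverse S ?R" by (rule is_tinverse_if_left_inverse[OF S R p])
  \<comment> \<open>With at least one slice, inverses are unique, so the definite description in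
    \<open>tinverse\<close> denotes the inverse just found.\<close>
  moreover have "length S \<ge> 1" using tensors_dims[OF S p] p by simp
  ultimately show ?thesis using tinverse_eqI by (auto simp: tinvertible_def)
qed

end
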